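(* Let $\{g_i\}_{i=1}^\infty$ be a general pre-Fréchet frame for $X_F$ with respect to $\Theta_F$, and let $U:X_F\to\Theta_F$, $Uf=\{g_i(f)\}_{i=1}^\infty$, with range $R(U)$. Then the following holds. (i) $R(U)$ is closed in $\Theta_F$, and the inverse operator $U^{-1}:R(U)\to X_F$ is continuous. (ii) The existence of a continuous projection $\mathcal P$ from $\Theta_F$ onto $R(U)$ (i.e. $R(U)$ being complemented in $\Theta_F$) is equivalent to the existence of a continuous operator $V:\Theta_F\to X_F$ such that $V\{g_i(f)\}_{i=1}^\infty=f$ for all $f\in X_F$.
   Context: Linear mappings are called operators; a projection of a space $X$ onto a subspace $Z$ is an operator $P:X\to Z$ with range $Z$ and $P^2=P$. $\mathbb N_0=\{0,1,2,\dots\}$. A $BK$-space is a Banach space of scalar sequences on which all coordinate functionals are continuous. Admissible scale: a sequence $\{(Y_s,|\cdot|_s)\}_{s\in\mathbb N_0}$ of separable Banach spaces such that $\{0\}\ne\bigcap_{s\in\mathbb N_0}Y_s\subseteq\dots\subseteq Y_2\subseteq Y_1\subseteq Y_0$; $|\cdot|_0\le|\cdot|_1\le|\cdot|_2\le\cdots$ (each inequality on the smaller space); and $Y_F:=\bigcap_{s\in\mathbb N_0}Y_s$ is dense in $Y_s$ for every $s\in\mathbb N_0$. $Y_F$ is a Fréchet space with the sequence of norms $|\cdot|_s$, $s\in\mathbb N_0$. Throughout, $X_F=\bigcap_s X_s$ is the Fréchet space of an admissible scale $\{(X_s,\|\cdot\|_s)\}_{s\in\mathbb N_0}$, and $\Theta_F=\bigcap_s\Theta_s$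 is the Fréchet space of an admissible scale $\{(\Theta_s,|||\cdot|||_s)\}_{s\in\mathbb N_0}$ of $BK$-spaces. $X_F^*$ is the topological dual of $X_F$. A sequence $\{g_i\}_{i=1}^\infty$ in $X_F^*$ is a general pre-Fréchet frame for $X_F$ with respect to $\Theta_F$ if there exist sequences $\{\widetilde s_k\}_{k\in\mathbb N_0},\{s_k\}_{k\in\mathbb N_0}\subseteq\mathbb N_0$ which increase to $\infty$, with $s_k\le\widetilde s_k$ for all $k\in\mathbb N_0$, and constants $A_k,B_k>0$, $k\in\mathbb N_0$, such that for all $f\in X_F$ and all $k\in\mathbb N_0$: $\{g_i(f)\}_{i=1}^\infty\in\Theta_F$ and $A_k\|f\|_{s_k}\le|||\{g_i(f)\}_{i=1}^\infty|||_k\le B_k\|f\|_{\widetilde s_k}$. (In particular $U$ is injective and continuous.) *)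

theory Defs
  imports "HOL-Analysis.Analysis" "HOL-Library.Function_Algebras"
begin

text \<open>
  The scalar field is a type of class \<open>real_normed_field\<close>; up to isometric isomorphism the
  instances are exactly the real and the complex numbers, so both cases are treated at once.
  A space of a scale is a subset of a carrier vector space together with a norm
  function, whose values outside the subset are irrelevant.
\<close>

definition norm_dist :: "'a::ab_group_add set \<Rightarrow> ('a \<Rightarrow> real) \<Rightarrow> 'a \<Rightarrow> 'a \<Rightarrow> real" where
  "norm_dist S n x y = (if x \<in> S \<and> y \<in> S then n (x - y) else 0)"
  \<comment> \<open>the value 0 outside \<open>S\<close> is due to \<open>Metric_space\<close>, which requires a globally
      nonnegative and symmetric distance\<close>

abbreviation norm_topology :: "'a::ab_group_add set \<Rightarrow> ('a \<Rightarrow> real) \<Rightarrow> 'a topology" where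
  "norm_topology S n \<equiv> Metric_space.mtopology S (norm_dist S n)"

locale normed_subspace = vector_space scale
  for scale :: "'k::real_normed_field \<Rightarrow> 'a::ab_group_add \<Rightarrow> 'a" +
  fixes S :: "'a set" and n :: "'a \<Rightarrow> real"
  assumes subspace_S: "subspace S"
    and norm_eq_0: "x \<in> S \<Longrightarrow> n x = 0 \<Longrightarrow> x = 0"
    and norm_scale: "x \<in> S \<Longrightarrow> n (scale c x) = norm c * n x"
    and norm_triangle: "x \<in> S \<Longrightarrow> y \<in> S \<Longrightarrow> n (x + y) \<le> n x + n y"
begin

lemma norm_zero: "n 0 = 0"
  using norm_scale[of 0 0] subspace_0[OF subspace_S] by simp

lemma norm_minus: "x \<in> S \<Longrightarrow> n (- x) = n x"
  using norm_scale[of x "-1"] by simp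

lemma norm_nonneg: "x \<in> S \<Longrightarrow> 0 \<le> n x"
  using norm_triangle[of x "- x"] norm_minus[of x] subspace_neg[OF subspace_S, of x] norm_zero
  by simp

lemma Metric_space_norm_dist: "Metric_space S (norm_dist S n)"
proof
  show "0 \<le> norm_dist S n x y" for x y
    using norm_nonneg subspace_diff[OF subspace_S] by (simp add: norm_dist_def)
  show "norm_dist S n x y = norm_dist S n y x" for x y
    using norm_minus[of "x - y"] subspace_diff[OF subspace_S] by (simp add: norm_dist_def)
  show "norm_dist S n x y = 0 \<longleftrightarrow> x = y" if "x \<in> S" "y \<in> S" for x y
    using that norm_eq_0[of "x - y"] norm_zero subspace_diff[OF subspace_S]
    by (auto simp: norm_dist_def)
  show "norm_dist S n x z \<le> norm_dist S n x y + norm_dist S n y z"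
    if "x \<in> S" "y \<in> S" "z \<in> S" for x y z
    using that norm_triangle[of "x - y" "y - z"] subspace_diff[OF subspace_S]
    by (simp add: norm_dist_def)
qed

end

locale banach_subspace = normed_subspace +
  assumes complete: "Metric_space.mcomplete S (norm_dist S n)"

locale admissible_scale = vector_space scale
  for scale :: "'k::real_normed_field \<Rightarrow> 'a::ab_group_add \<Rightarrow> 'a" +
  fixes Y :: "nat \<Rightarrow> 'a set" and nrm :: "nat \<Rightarrow> 'a \<Rightarrow> real"
  assumes banach: "banach_subspace scale (Y s) (nrm s)"
    and separable: "separable_space (norm_topology (Y s) (nrm s))"
    and nontrivial: "(\<Inter>s. Y s) \<noteq> {0}"
    and decreasing: "Y (Suc s) \<subseteq> Y s"
    and norm_mono: "x \<in> Y (Suc s) \<Longrightarrow> nrm s x \<le> nrm (Suc s) x"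
    and dense: "norm_topology (Y s) (nrm s) closure_of (\<Inter>t. Y t) = Y s"

text \<open>The topology of \<open>Y\<^sub>F\<close>, which is the coarsest one containing all open balls
  of all the norms. Its underlying set is \<open>Y\<^sub>F\<close>.\<close>

definition frechet_topology :: "(nat \<Rightarrow> 'a::ab_group_add set) \<Rightarrow> (nat \<Rightarrow> 'a \<Rightarrow> real) \<Rightarrow> 'a topology" where
  "frechet_topology Y nrm =
     topology_generated_by
       {{y \<in> (\<Inter>t. Y t). nrm s (y - x) < e} | s x e. x \<in> (\<Inter>t. Y t) \<and> e > 0}"

lemma (in admissible_scale) topspace_frechet_topology [simp]:
  "topspace (frechet_topology Y nrm) = (\<Inter>s. Y s)"
proof -
  have ball: "x \<in> {y \<in> (\<Inter>t. Y t). nrm 0 (y - x) < 1}" if "x \<in> (\<Inter>t. Y t)" for x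
    using that normed_subspace.norm_zero[OF banach_subspace.axioms(1)[OF banach]] by simp
  show ?thesis
    unfolding frechet_topology_def topology_generated_by_topspace
  proof (intro subset_antisym subsetI)
    fix x assume x: "x \<in> (\<Inter>t. Y t)"
    then show "x \<in> \<Union>{{y \<in> (\<Inter>t. Y t). nrm s (y - x) < e} | s x e. x \<in> (\<Inter>t. Y t) \<and> e > 0}"
      by (intro UnionI[OF _ ball[OF x]] CollectI exI[of _ "0::nat"] exI[of _ x] exI[of _ "1::real"])
        simp
  qed (elim UnionE CollectE exE conjE, simp)
qed

text \<open>Sequences are indexed from 0 instead of 1; \<open>nat \<Rightarrow> 'k\<close> carries the pointwise
  operations.\<close>

definition seq_scale :: "'k::real_normed_field \<Rightarrow> (nat \<Rightarrow> 'k) \<Rightarrow> nat \<Rightarrow> 'k" where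
  "seq_scale c x = (\<lambda>i. c * x i)"

interpretation seq: vector_space seq_scale
  by unfold_locales (simp_all add: seq_scale_def fun_eq_iff distrib_left distrib_right mult.assoc)

definition BK_space :: "(nat \<Rightarrow> 'k::real_normed_field) set \<Rightarrow> ((nat \<Rightarrow> 'k) \<Rightarrow> real) \<Rightarrow> bool" where
  "BK_space S n \<longleftrightarrow>
     banach_subspace seq_scale S n \<and>
     (\<forall>i. continuous_map (norm_topology S n) euclidean (\<lambda>x. x i))"

definition linear_on ::
    "('k \<Rightarrow> 'a::ab_group_add \<Rightarrow> 'a) \<Rightarrow> ('k \<Rightarrow> 'b::ab_group_add \<Rightarrow> 'b) \<Rightarrow> 'a set \<Rightarrow> ('a \<Rightarrow> 'b) \<Rightarrow> bool" where
  "linear_on sa sb S f \<longleftrightarrow>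
     (\<forall>x\<in>S. \<forall>y\<in>S. f (x + y) = f x + f y) \<and>
     (\<forall>c. \<forall>x\<in>S. f (sa c x) = sb c (f x))"

definition continuous_operator ::
    "('k \<Rightarrow> 'a::ab_group_add \<Rightarrow> 'a) \<Rightarrow> 'a topology \<Rightarrow>
     ('k \<Rightarrow> 'b::ab_group_add \<Rightarrow> 'b) \<Rightarrow> 'b topology \<Rightarrow> ('a \<Rightarrow> 'b) \<Rightarrow> bool" where
  "continuous_operator sa Ta sb Tb f \<longleftrightarrow>
     linear_on sa sb (topspace Ta) f \<and> continuous_map Ta Tb f"

definition topological_dual ::
    "('k::real_normed_field \<Rightarrow> 'a::ab_group_add \<Rightarrow> 'a) \<Rightarrow> 'a topology \<Rightarrow> ('a \<Rightarrow> 'k) set" where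
  "topological_dual sa T = {g. continuous_operator sa T (*) euclidean g}"

definition continuous_projection ::
    "('k \<Rightarrow> 'a::ab_group_add \<Rightarrow> 'a) \<Rightarrow> 'a topology \<Rightarrow> 'a set \<Rightarrow> ('a \<Rightarrow> 'a) \<Rightarrow> bool" where
  "continuous_projection sa T Z P \<longleftrightarrow>
     continuous_operator sa T sa (subtopology T Z) P \<and>
     P ` topspace T = Z \<and> (\<forall>x\<in>topspace T. P (P x) = P x)"

definition general_pre_frechet_frame ::
    "('k::real_normed_field \<Rightarrow> 'a::ab_group_add \<Rightarrow> 'a) \<Rightarrow>
     (nat \<Rightarrow> 'a set) \<Rightarrow> (nat \<Rightarrow> 'a \<Rightarrow> real) \<Rightarrow>
     (nat \<Rightarrow> (nat \<Rightarrow> 'k) set) \<Rightarrow> (nat \<Rightarrow> (nat \<Rightarrow> 'k) \<Rightarrow> real) \<Rightarrow>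
     (nat \<Rightarrow> 'a \<Rightarrow> 'k) \<Rightarrow> bool" where
  "general_pre_frechet_frame sa X nX \<Theta> n\<Theta> g \<longleftrightarrow>
     (\<forall>i. g i \<in> topological_dual sa (frechet_topology X nX)) \<and>
     (\<exists>(s' :: nat \<Rightarrow> nat) (s :: nat \<Rightarrow> nat) (A :: nat \<Rightarrow> real) (B :: nat \<Rightarrow> real).
        mono s' \<and> filterlim s' at_top sequentially \<and>
        mono s \<and> filterlim s at_top sequentially \<and>
        (\<forall>k. s k \<le> s' k) \<and> (\<forall>k. A k > 0 \<and> B k > 0) \<and>
        (\<forall>f \<in> (\<Inter>t. X t). \<forall>k.
           (\<lambda>i. g i f) \<in> (\<Inter>t. \<Theta> t) \<and>
           A k * nX (s k) f \<le> n\<Theta> k (\<lambda>i. g i f) \<and>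
           n\<Theta> k (\<lambda>i. g i f) \<le> B k * nX (s' k) f))"

definition analysis_operator :: "(nat \<Rightarrow> 'a \<Rightarrow> 'k) \<Rightarrow> 'a \<Rightarrow> nat \<Rightarrow> 'k" where
  "analysis_operator g f = (\<lambda>i. g i f)"

end

theory Submission
  imports Defs
begin

text \<open>
  The lower frame bounds make \<open>U\<^sup>-\<^sup>1\<close> a linear map that is bounded with respect to the
  two families of norms, hence continuous. If \<open>U f\<^sub>n\<close> converges, the same bounds make \<open>f\<^sub>n\<close>
  Cauchy in every \<open>X\<^sub>s\<close>; all the limits agree because the norms increase, so \<open>f\<^sub>n\<close>
  converges in \<open>X\<^sub>F\<close>, and the upper bounds identify the limit of \<open>U f\<^sub>n\<close>. Hence the
  range is closed. A projection \<open>P\<close> and a left inverse \<open>V\<close> determine each other through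
  \<open>V = U\<^sup>-\<^sup>1 P\<close> and \<open>P = U V\<close>.
\<close>

section \<open>Topology and completeness of the Frechet space of one scale\<close>

context admissible_scale
begin

lemma normed_subspace_level: "normed_subspace scale (Y s) (nrm s)"
  using banach banach_subspace.axioms(1) by blast

lemmas level_zero = normed_subspace.norm_zero[OF normed_subspace_level]
lemmas level_minus = normed_subspace.norm_minus[OF normed_subspace_level]
lemmas level_nonneg = normed_subspace.norm_nonneg[OF normed_subspace_level]
lemmas level_eq_0 = normed_subspace.norm_eq_0[OF normed_subspace_level]
lemmas level_triangle = normed_subspace.norm_triangle[OF normed_subspace_level]
lemmas level_subspace = normed_subspace.subspace_S[OF normed_subspace_level]

lemma subspace_frechet: "subspace (\<Inter>t. Y t)"
  using level_subspace by (simp add: subspace_Inter)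

lemma Y_antimono: "s \<le> t \<Longrightarrow> Y t \<subseteq> Y s"
  using decreasing by (rule lift_Suc_antimono_le)

lemma norm_level_mono:
  assumes "s \<le> t" "x \<in> Y t"
  shows "nrm s x \<le> nrm t x"
  using assms
proof (induction rule: dec_induct)
  case (step m)
  then show ?case
    using decreasing[of m] norm_mono[of x m] by fastforce
qed simp

lemma level_diff_commute:
  assumes "x \<in> Y s" "y \<in> Y s"
  shows "nrm s (x - y) = nrm s (y - x)"
  using level_minus[of "x - y" s] assms subspace_diff[OF level_subspace] by simp

lemma level_diff_triangle:
  assumes "x \<in> Y s" "y \<in> Y s" "z \<in> Y s"
  shows "nrm s (x - z) \<le> nrm s (x - y) + nrm s (y - z)"
  using level_triangle[of "x - y" s "y - z"] assms subspace_diff[OF level_subspace] by simp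

lemma openin_frechet_ball:
  assumes "x \<in> (\<Inter>t. Y t)" "e > 0"
  shows "openin (frechet_topology Y nrm) {y \<in> (\<Inter>t. Y t). nrm s (y - x) < e}"
  unfolding frechet_topology_def
  by (rule topology_generated_by_Basis) (use assms in fast)

text \<open>The generating balls use one norm each, and a priori they form only a subbasis. Because
  the norms increase, two balls about \<open>x\<close> contain a common ball about \<open>x\<close>
  in the norm with the larger index, so the balls of single norms already give neighbourhood
  bases.\<close>

lemma openin_frechet_topology_iff:
  "openin (frechet_topology Y nrm) S \<longleftrightarrow>
     S \<subseteq> (\<Inter>t. Y t) \<and> (\<forall>x\<in>S. \<exists>s. \<exists>e>0. {y \<in> (\<Inter>t. Y t). nrm s (y - x) < e} \<subseteq> S)"
  (is "_ \<longleftrightarrow> _ \<and> ?nbhds S")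
proof
  let ?B = "{{y \<in> (\<Inter>t. Y t). nrm s (y - x) < e} | s x e. x \<in> (\<Inter>t. Y t) \<and> e > 0}"
  assume S: "openin (frechet_topology Y nrm) S"
  then have sub: "S \<subseteq> (\<Inter>t. Y t)"
    using openin_subset topspace_frechet_topology by metis
  have "generate_topology_on ?B S"
    using S unfolding frechet_topology_def openin_topology_generated_by_iff .
  then have "?nbhds S"
  proof induction
    case Empty
    then show ?case by simp
  next
    case (Int a b)
    show ?case
    proof
      fix x assume "x \<in> a \<inter> b"
      then obtain s e t d where
        *: "0 < e" "{y \<in> (\<Inter>t. Y t). nrm s (y - x) < e} \<subseteq> a"
           "0 < d" "{y \<in> (\<Inter>t. Y t). nrm t (y - x) < d} \<subseteq> b"
        using Int.IH(1)[THEN bspec, of x] Int.IH(2)[THEN bspec, of x] by auto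
      \<comment> \<open>Monotonicity of the norms is available only for vectors of the smaller
        space, so \<open>y - x\<close> must be known to lie in every level.\<close>
      have "x \<in> (\<Inter>t. Y t)"
        using Int.hyps \<open>x \<in> a \<inter> b\<close> topspace_frechet_topology
          openin_subset[of "frechet_topology Y nrm" a]
        by (auto simp: frechet_topology_def openin_topology_generated_by_iff)
      then have mem: "y - x \<in> Y r" if "y \<in> (\<Inter>t. Y t)" for y r
        using that subspace_diff[OF level_subspace] by blast
      have "{y \<in> (\<Inter>t. Y t). nrm (max s t) (y - x) < min e d} \<subseteq> a \<inter> b"
      proof
        fix y assume y: "y \<in> {y \<in> (\<Inter>t. Y t). nrm (max s t) (y - x) < min e d}"
        then have "nrm s (y - x) < e" "nrm t (y - x) < d"
          using norm_level_mono[of s "max s t" "y - x"] norm_level_mono[of t "max s t" "y - x"]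
            mem[of y] by auto
        with y * show "y \<in> a \<inter> b" by auto
      qed
      then show "\<exists>s. \<exists>e>0. {y \<in> (\<Inter>t. Y t). nrm s (y - x) < e} \<subseteq> a \<inter> b"
        using * by (intro exI[of _ "max s t"] exI[of _ "min e d"]) simp
    qed
  next
    case (UN K)
    then show ?case by (meson Union_iff Union_upper subset_trans)
  next
    case (Basis b)
    then obtain s x e where b: "b = {y \<in> (\<Inter>t. Y t). nrm s (y - x) < e}"
      and x: "x \<in> (\<Inter>t. Y t)" by blast
    show ?case
    proof
      fix z assume z: "z \<in> b"
      \<comment> \<open>A basic set is centred at \<open>x\<close>, not at the given point
        \<open>z\<close>; the radius left over at \<open>z\<close> is positive since
        \<open>z\<close> lies in \<open>b\<close>.\<close>
      have "{y \<in> (\<Inter>t. Y t). nrm s (y - z) < e - nrm s (z - x)} \<subseteq> b"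
        using level_diff_triangle[of _ s z x] x z by (fastforce simp: b)
      then show "\<exists>s. \<exists>e>0. {y \<in> (\<Inter>t. Y t). nrm s (y - z) < e} \<subseteq> b"
        using z b by (intro exI[of _ s] exI[of _ "e - nrm s (z - x)"]) simp
    qed
  qed
  with sub show "S \<subseteq> (\<Inter>t. Y t) \<and> ?nbhds S" ..
next
  assume S: "S \<subseteq> (\<Inter>t. Y t) \<and> ?nbhds S"
  have "\<exists>T. openin (frechet_topology Y nrm) T \<and> x \<in> T \<and> T \<subseteq> S" if "x \<in> S" for x
  proof -
    from that S obtain s e where se: "e > 0" "{y \<in> (\<Inter>t. Y t). nrm s (y - x) < e} \<subseteq> S"
      by blast
    have "openin (frechet_topology Y nrm) {y \<in> (\<Inter>t. Y t). nrm s (y - x) < e}"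
      using that S se by (intro openin_frechet_ball) auto
    moreover have "x \<in> {y \<in> (\<Inter>t. Y t). nrm s (y - x) < e}"
      using that S se level_zero by auto
    ultimately show ?thesis using se by blast
  qed
  then show "openin (frechet_topology Y nrm) S"
    by (subst openin_subopen) blast
qed

text \<open>Countably many increasing norms make sequences sufficient for testing closedness. A
  diagonal choice of points proves this without introducing a metric on the intersection.\<close>

lemma closedin_frechet_topologyI:
  assumes sub: "C \<subseteq> (\<Inter>t. Y t)"
    and seq: "\<And>y c. y \<in> (\<Inter>t. Y t) \<Longrightarrow> (\<And>n. c n \<in> C) \<Longrightarrow>
      (\<And>s. (\<lambda>n. nrm s (c n - y)) \<longlonglongrightarrow> 0) \<Longrightarrow> y \<in> C"
  shows "closedin (frechet_topology Y nrm) C"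
proof -
  have "\<exists>s. \<exists>e>0. {z \<in> (\<Inter>t. Y t). nrm s (z - y) < e} \<subseteq> (\<Inter>t. Y t) - C"
    if y: "y \<in> (\<Inter>t. Y t) - C" for y
  proof (rule ccontr)
    assume contra: "\<not> ?thesis"
    \<comment> \<open>The index \<open>n\<close> sets both the norm and the radius. For fixed
      \<open>s\<close>, all terms with \<open>n \<ge> s\<close> are then controlled in norm
      \<open>s\<close> too, which gives convergence in every norm.\<close>
    have "\<exists>z\<in>C. nrm n (z - y) < inverse (real (Suc n))" for n
    proof (rule ccontr)
      assume "\<not> ?thesis"
      then have "{z \<in> (\<Inter>t. Y t). nrm n (z - y) < inverse (real (Suc n))} \<subseteq> (\<Inter>t. Y t) - C"
        by blast
      moreover have "inverse (real (Suc n)) > 0" by simp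
      ultimately show False using contra by blast
    qed
    then obtain c where c: "\<And>n. c n \<in> C" "\<And>n. nrm n (c n - y) < inverse (real (Suc n))"
      by metis
    have mem: "c n - y \<in> Y s" for n s
      using c(1)[of n] sub y by (intro subspace_diff[OF level_subspace]) auto
    have "(\<lambda>n. nrm s (c n - y)) \<longlonglongrightarrow> 0" for s
    proof (rule tendsto_sandwich[OF _ _ tendsto_const LIMSEQ_inverse_real_of_nat])
      show "\<forall>\<^sub>F n in sequentially. 0 \<le> nrm s (c n - y)"
        using level_nonneg mem by simp
      show "\<forall>\<^sub>F n in sequentially. nrm s (c n - y) \<le> inverse (real (Suc n))"
        using eventually_ge_at_top[of s]
      proof eventually_elim
        case (elim n)
        then show ?case
          using norm_level_mono[OF elim mem] c(2)[of n] by (meson less_imp_le order_trans)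
      qed
    qed
    then have "y \<in> C" using y c(1) by (intro seq[of y c]) simp_all
    with y show False by blast
  qed
  then show ?thesis
    using sub by (auto simp: closedin_def openin_frechet_topology_iff)
qed

text \<open>Completeness of each level yields a limit there. Convergence in norm \<open>s\<close>
  implies convergence in norm 0, so every one of these limits is the limit in \<open>Y 0\<close>,
  which therefore belongs to all levels.\<close>

lemma frechet_complete:
  assumes f: "\<And>n. f n \<in> (\<Inter>t. Y t)"
    and cauchy: "\<And>s e. e > 0 \<Longrightarrow> \<exists>N. \<forall>m\<ge>N. \<forall>n\<ge>N. nrm s (f m - f n) < e"
  obtains l where "l \<in> (\<Inter>t. Y t)" "\<And>s. (\<lambda>n. nrm s (f n - l)) \<longlonglongrightarrow> 0"
proof -
  have fY: "f n \<in> Y s" for n s using f[of n] by simp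
  have "\<exists>l\<in>Y s. (\<lambda>n. nrm s (f n - l)) \<longlonglongrightarrow> 0" for s
  proof -
    interpret M: Metric_space "Y s" "norm_dist (Y s) (nrm s)"
      by (rule normed_subspace.Metric_space_norm_dist[OF normed_subspace_level])
    \<comment> \<open>All terms lie in \<open>Y s\<close>, so \<open>norm_dist\<close> is the norm
      of the difference here and not its default value 0.\<close>
    have "M.MCauchy f"
      using fY cauchy by (auto simp: M.MCauchy_def norm_dist_def)
    moreover have "M.mcomplete"
      using banach by (rule banach_subspace.complete)
    ultimately obtain l where l: "limitin M.mtopology f l sequentially"
      unfolding M.mcomplete_def by blast
    then have "l \<in> Y s" "(\<lambda>n. norm_dist (Y s) (nrm s) (f n) l) \<longlonglongrightarrow> 0"
      unfolding M.limitin_metric_dist_null by auto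
    then show ?thesis using fY by (auto simp: norm_dist_def)
  qed
  then obtain l where l: "\<And>s. l s \<in> Y s" "\<And>s. (\<lambda>n. nrm s (f n - l s)) \<longlonglongrightarrow> 0"
    by metis
  have l0: "l s \<in> Y 0" for s
    using l(1) Y_antimono[of 0 s] by blast
  have eq: "l s = l 0" for s
  proof -
    have "(\<lambda>n. nrm s (f n - l s) + nrm 0 (f n - l 0)) \<longlonglongrightarrow> 0"
      using tendsto_add[OF l(2)[of s] l(2)[of 0]] by simp
    \<comment> \<open>Level 0 is where any two of the limits can be compared: it contains all of
      them, and its norm is the smallest.\<close>
    moreover have "nrm 0 (l s - l 0) \<le> nrm s (f n - l s) + nrm 0 (f n - l 0)" for n
      using level_diff_triangle[of "l s" 0 "f n" "l 0"] level_diff_commute[of "l s" 0 "f n"]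
        norm_level_mono[of 0 s "f n - l s"] l0 fY l(1) subspace_diff[OF level_subspace]
      by fastforce
    ultimately have "nrm 0 (l s - l 0) \<le> 0"
      by (intro LIMSEQ_le_const) auto
    moreover have "l s - l 0 \<in> Y 0"
      using l0 subspace_diff[OF level_subspace] by blast
    ultimately have "l s - l 0 = 0"
      using level_nonneg level_eq_0 by (meson order_antisym)
    then show ?thesis by simp
  qed
  show thesis
  proof
    show "l 0 \<in> (\<Inter>t. Y t)" using l(1) eq by (metis INT_I)
    show "(\<lambda>n. nrm s (f n - l 0)) \<longlonglongrightarrow> 0" for s using l(2)[of s] eq[of s] by simp
  qed
qed

end

section \<open>Continuous linear maps between two scales\<close>

text \<open>By linearity, an estimate of each target norm by some source norm is an estimate for
  differences, hence continuity at every point. Allowing a subspace \<open>Z\<close> as domain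
  covers both an operator on the whole space and the inverse operator on a range.\<close>

lemma continuous_map_frechet_topologyI:
  assumes "admissible_scale sa X nX" and "admissible_scale sb Y nY"
    and Z: "module.subspace sa Z" "Z \<subseteq> (\<Inter>t. X t)"
    and f: "f \<in> Z \<rightarrow> (\<Inter>t. Y t)" "linear_on sa sb Z f"
    and bound: "\<And>s. \<exists>t C. \<forall>x\<in>Z. nY s (f x) \<le> C * nX t x"
  shows "continuous_map (subtopology (frechet_topology X nX) Z) (frechet_topology Y nY) f"
proof -
  interpret X: admissible_scale sa X nX by fact
  interpret Y: admissible_scale sb Y nY by fact
  have diff: "f (x - y) = f x - f y" if "x \<in> Z" "y \<in> Z" for x y
  proof -
    have "f ((x - y) + y) = f (x - y) + f y"
      using f(2) that X.subspace_diff[OF Z(1)] unfolding linear_on_def by blast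
    then show ?thesis by simp
  qed
  have "openin (subtopology (frechet_topology X nX) Z) {x \<in> Z. f x \<in> S}"
    if S: "openin (frechet_topology Y nY) S" for S
  proof (subst openin_subopen, intro ballI)
    fix x assume x: "x \<in> {x \<in> Z. f x \<in> S}"
    then obtain s e where e: "e > 0" and ball: "{y \<in> (\<Inter>t. Y t). nY s (y - f x) < e} \<subseteq> S"
      using S unfolding Y.openin_frechet_topology_iff by blast
    obtain t C where C: "\<And>x. x \<in> Z \<Longrightarrow> nY s (f x) \<le> C * nX t x"
      using bound by blast
    \<comment> \<open>The bound \<open>C\<close> may be zero or negative;
      \<open>\<bar>C\<bar> + 1\<close> is a positive constant that dominates it.\<close>
    define d where "d = e / (\<bar>C\<bar> + 1)"
    have d: "d > 0" using e by (simp add: d_def add_nonneg_pos)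
    let ?T = "{y \<in> (\<Inter>t. X t). nX t (y - x) < d}"
    have "openin (frechet_topology X nX) ?T"
      using x Z(2) d by (intro X.openin_frechet_ball) auto
    then have "openin (subtopology (frechet_topology X nX) Z) (?T \<inter> Z)"
      by (auto simp: openin_subtopology)
    moreover have "x \<in> ?T \<inter> Z"
      using x Z(2) d X.level_zero by auto
    moreover have "?T \<inter> Z \<subseteq> {x \<in> Z. f x \<in> S}"
    proof
      fix y assume y: "y \<in> ?T \<inter> Z"
      have mem: "y - x \<in> Z" using x y X.subspace_diff[OF Z(1)] by blast
      have nonneg: "0 \<le> nX t (y - x)" using X.level_nonneg mem Z(2) by blast
      have "nY s (f y - f x) \<le> C * nX t (y - x)"
        using C[OF mem] diff x y by simp
      also have "\<dots> \<le> (\<bar>C\<bar> + 1) * nX t (y - x)"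
        using nonneg by (intro mult_right_mono) auto
      also have "\<dots> < (\<bar>C\<bar> + 1) * d"
        using y by (intro mult_strict_left_mono) auto
      also have "\<dots> = e" by (simp add: d_def add_nonneg_eq_0_iff)
      finally show "y \<in> {x \<in> Z. f x \<in> S}" using y f(1) ball by blast
    qed
    ultimately show "\<exists>T. openin (subtopology (frechet_topology X nX) Z) T \<and> x \<in> T \<and>
        T \<subseteq> {x \<in> Z. f x \<in> S}" by blast
  qed
  moreover have "topspace (subtopology (frechet_topology X nX) Z) = Z"
    using Z(2) by auto
  ultimately show ?thesis
    using f(1) by (auto simp: continuous_map_def)
qed

lemma linear_on_compose:
  assumes "linear_on sa sb A f" "linear_on sb sc B h" "f \<in> A \<rightarrow> B"
  shows "linear_on sa sc A (h \<circ> f)"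
  using assms unfolding linear_on_def by (simp add: Pi_iff)

text \<open>Linearity is required only on the carrier, so the first map must send carrier to
  carrier; its continuity includes this.\<close>

lemma continuous_operator_compose:
  assumes "continuous_operator sa Ta sb Tb f" "continuous_operator sb Tb sc Tc h"
  shows "continuous_operator sa Ta sc Tc (h \<circ> f)"
  using assms unfolding continuous_operator_def
  by (meson continuous_map_compose continuous_map_funspace linear_on_compose)

section \<open>Range, inverse and left inverses of the analysis operator of a frame\<close>

theorem proposition2p6:
  fixes scaleX :: "'k::real_normed_field \<Rightarrow> 'a::ab_group_add \<Rightarrow> 'a"
    and X :: "nat \<Rightarrow> 'a set" and nX :: "nat \<Rightarrow> 'a \<Rightarrow> real"
    and \<Theta> :: "nat \<Rightarrow> (nat \<Rightarrow> 'k) set" and n\<Theta> :: "nat \<Rightarrow> (nat \<Rightarrow> 'k) \<Rightarrow> real"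
    and g :: "nat \<Rightarrow> 'a \<Rightarrow> 'k"
  assumes "admissible_scale scaleX X nX"
    and "admissible_scale seq_scale \<Theta> n\<Theta>"
    and "\<And>s. BK_space (\<Theta> s) (n\<Theta> s)"
    and "general_pre_frechet_frame scaleX X nX \<Theta> n\<Theta> g"
  defines "XF \<equiv> \<Inter>s. X s"
    and "TX \<equiv> frechet_topology X nX"
    and "T\<Theta> \<equiv> frechet_topology \<Theta> n\<Theta>"
    and "U \<equiv> analysis_operator g"
  shows "(closedin T\<Theta> (U ` XF) \<and>
         inj_on U XF \<and>
         continuous_operator seq_scale (subtopology T\<Theta> (U ` XF)) scaleX TX (inv_into XF U)) \<and>
         ((\<exists>P. continuous_projection seq_scale T\<Theta> (U ` XF) P) \<longleftrightarrow>
         (\<exists>V. continuous_operator seq_scale T\<Theta> scaleX TX V \<and>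
              (\<forall>f\<in>XF. V (\<lambda>i. g i f) = f)))"
proof -
  interpret X: admissible_scale scaleX X nX by fact
  interpret \<Theta>: admissible_scale seq_scale \<Theta> n\<Theta> by fact
  have top: "topspace TX = XF" "topspace T\<Theta> = (\<Inter>t. \<Theta> t)"
    by (simp_all add: TX_def T\<Theta>_def XF_def)
  have subXF: "X.subspace XF"
    unfolding XF_def by (rule X.subspace_frechet)
  have gdual: "\<And>i. g i \<in> topological_dual scaleX TX"
    using assms(4) by (simp add: general_pre_frechet_frame_def TX_def)
  obtain s' s :: "nat \<Rightarrow> nat" and A B :: "nat \<Rightarrow> real"
    where frame: "\<forall>f \<in> (\<Inter>t. X t). \<forall>k. (\<lambda>i. g i f) \<in> (\<Inter>t. \<Theta> t) \<and>
      A k * nX (s k) f \<le> n\<Theta> k (\<lambda>i. g i f) \<and> n\<Theta> k (\<lambda>i. g i f) \<le> B k * nX (s' k) f"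
      and s: "filterlim s at_top sequentially" and AB: "\<forall>k. A k > 0 \<and> B k > 0"
    using assms(4) unfolding general_pre_frechet_frame_def
    by (elim conjE exE) (rule that)
  have pos: "\<And>k. A k > 0" using AB by blast
  have U_mem: "\<And>f. f \<in> XF \<Longrightarrow> U f \<in> (\<Inter>t. \<Theta> t)"
    and lower: "\<And>f k. f \<in> XF \<Longrightarrow> A k * nX (s k) f \<le> n\<Theta> k (U f)"
    and upper: "\<And>f k. f \<in> XF \<Longrightarrow> n\<Theta> k (U f) \<le> B k * nX (s' k) f"
    using frame by (simp_all add: XF_def U_def analysis_operator_def)
  have U_linear: "linear_on scaleX seq_scale XF U"
    using gdual unfolding topological_dual_def continuous_operator_def linear_on_def top
    by (simp add: U_def analysis_operator_def seq_scale_def fun_eq_iff)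
  then have U_add: "\<And>x y. x \<in> XF \<Longrightarrow> y \<in> XF \<Longrightarrow> U (x + y) = U x + U y"
    and U_scale: "\<And>x c. x \<in> XF \<Longrightarrow> U (scaleX c x) = seq_scale c (U x)"
    unfolding linear_on_def by auto
  have U_diff: "U (x - y) = U x - U y" if "x \<in> XF" "y \<in> XF" for x y
    using U_add[of "x - y" y] X.subspace_diff[OF subXF] that by simp
  \<comment> \<open>The frame inequality bounds only the norms with index \<open>s k\<close>. As
    \<open>s\<close> tends to infinity, some \<open>s k\<close> is at least \<open>t\<close>, and
    monotonicity of the norms reaches every \<open>t\<close>, with
    \<open>C = 1 / A k\<close>.\<close>
  have bounded_below: "\<exists>k C. C > 0 \<and> (\<forall>f\<in>XF. nX t f \<le> C * n\<Theta> k (U f))" for t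
  proof -
    obtain k where k: "t \<le> s k"
      using s unfolding filterlim_at_top eventually_sequentially by blast
    have "nX t f \<le> inverse (A k) * n\<Theta> k (U f)" if "f \<in> XF" for f
    proof -
      have "nX t f \<le> nX (s k) f"
        using X.norm_level_mono[OF k] that by (auto simp: XF_def)
      also have "\<dots> \<le> inverse (A k) * n\<Theta> k (U f)"
        using lower[OF that, of k] pos[of k] by (simp add: field_simps)
      finally show ?thesis .
    qed
    then show ?thesis using pos by (meson positive_imp_inverse_positive)
  qed
  have inj: "inj_on U XF"
  proof (rule inj_onI)
    fix x y assume xy: "x \<in> XF" "y \<in> XF" "U x = U y"
    then have mem: "x - y \<in> XF" using X.subspace_diff[OF subXF] by blast
    \<comment> \<open>Each level carries a norm, not merely a seminorm, so the estimate at level 0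
      alone separates points.\<close>
    obtain k C where "nX 0 (x - y) \<le> C * n\<Theta> k (U (x - y))"
      using bounded_below[of 0] mem by blast
    then have "nX 0 (x - y) \<le> 0"
      using xy U_diff \<Theta>.level_zero by simp
    moreover have "x - y \<in> X 0" using mem by (auto simp: XF_def)
    ultimately have "x - y = 0"
      using X.level_nonneg X.level_eq_0 by (meson order_antisym)
    then show "x = y" by simp
  qed
  have range_sub: "U ` XF \<subseteq> (\<Inter>t. \<Theta> t)" using U_mem by blast
  have range_subspace: "seq.subspace (U ` XF)"
  proof (rule seq.subspaceI)
    show "0 \<in> U ` XF"
      using U_diff[of 0 0] X.subspace_0[OF subXF] by (intro image_eqI[of _ _ 0]) simp_all
    show "x + y \<in> U ` XF" if "x \<in> U ` XF" "y \<in> U ` XF" for x y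
      using that by (auto simp: U_add[symmetric] X.subspace_add[OF subXF])
    show "seq_scale c x \<in> U ` XF" if "x \<in> U ` XF" for x c
      using that by (auto simp: U_scale[symmetric] X.subspace_scale[OF subXF])
  qed
  define W where "W = inv_into XF U"
  have W_U: "W (U f) = f" if "f \<in> XF" for f
    using that inj by (simp add: W_def)
  have W_linear: "linear_on seq_scale scaleX (U ` XF) W"
    unfolding linear_on_def
  proof (intro conjI ballI allI)
    fix x y assume "x \<in> U ` XF" "y \<in> U ` XF"
    then show "W (x + y) = W x + W y"
      by (auto simp: W_U U_add[symmetric] X.subspace_add[OF subXF])
  next
    fix c x assume "x \<in> U ` XF"
    then show "W (seq_scale c x) = scaleX c (W x)"
      by (auto simp: W_U U_scale[symmetric] X.subspace_scale[OF subXF])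
  qed
  have top_range: "topspace (subtopology T\<Theta> (U ` XF)) = U ` XF"
    using range_sub top by auto
  \<comment> \<open>This is \<open>bounded_below\<close> read at \<open>x = U f\<close>, the form
    that the continuity criterion needs.\<close>
  have "\<exists>k C. \<forall>x\<in>U ` XF. nX t (W x) \<le> C * n\<Theta> k x" for t
    using bounded_below[of t] W_U by fastforce
  then have W_cont: "continuous_operator seq_scale (subtopology T\<Theta> (U ` XF)) scaleX TX W"
    unfolding continuous_operator_def top_range unfolding T\<Theta>_def TX_def
    using range_subspace range_sub W_linear W_U
    by (intro conjI continuous_map_frechet_topologyI[OF assms(2,1)]) (auto simp: XF_def)
  have "\<exists>t C. \<forall>f\<in>XF. n\<Theta> k (U f) \<le> C * nX t f" for k
    using upper by blast
  then have "continuous_map (subtopology TX XF) T\<Theta> U"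
    unfolding T\<Theta>_def TX_def
    using subXF U_linear U_mem
    by (intro continuous_map_frechet_topologyI[OF assms(1,2)]) (auto simp: XF_def)
  then have "continuous_map TX T\<Theta> U"
    using top(1) subtopology_topspace[of TX] by simp
  \<comment> \<open>The target is narrowed to the range because a projection must be continuous into
    the subspace topology there.\<close>
  then have U_cont: "continuous_operator scaleX TX seq_scale (subtopology T\<Theta> (U ` XF)) U"
    using U_linear top(1) by (simp add: continuous_operator_def continuous_map_in_subtopology)
  have closed: "closedin T\<Theta> (U ` XF)"
    unfolding T\<Theta>_def
  proof (rule \<Theta>.closedin_frechet_topologyI[OF range_sub])
    fix y c assume y: "y \<in> (\<Inter>t. \<Theta> t)" and cU: "\<And>n::nat. c n \<in> U ` XF"
      and lim: "\<And>r. (\<lambda>n. n\<Theta> r (c n - y)) \<longlonglongrightarrow> 0"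
    have "\<forall>n. \<exists>f\<in>XF. c n = U f" using cU by blast
    then obtain f where f: "\<And>n. f n \<in> XF" and c: "\<And>n. c n = U (f n)"
      by metis
    have cY: "c n \<in> \<Theta> r" "y \<in> \<Theta> r" for n r
      using c f U_mem y by auto
    have cauchy: "\<exists>N. \<forall>m\<ge>N. \<forall>n\<ge>N. nX t (f m - f n) < e" if e: "e > 0" for t e
    proof -
      obtain k C where C: "C > 0" "\<And>f. f \<in> XF \<Longrightarrow> nX t f \<le> C * n\<Theta> k (U f)"
        using bounded_below by blast
      \<comment> \<open>Both \<open>c m\<close> and \<open>c n\<close> will lie within this distance
        of \<open>y\<close>, so their difference has norm below \<open>e / C\<close>, and the factor
        \<open>C\<close> from \<open>bounded_below\<close> restores \<open>e\<close>.\<close>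
      have "0 < e / (2 * C)" using e C by simp
      then obtain N where N: "\<And>n. n \<ge> N \<Longrightarrow> n\<Theta> k (c n - y) < e / (2 * C)"
        using order_tendstoD(2)[OF lim[of k]] unfolding eventually_sequentially by blast
      have "nX t (f m - f n) < e" if "m \<ge> N" "n \<ge> N" for m n
      proof -
        have "nX t (f m - f n) \<le> C * n\<Theta> k (c m - c n)"
          using C(2)[of "f m - f n"] f c U_diff X.subspace_diff[OF subXF] by simp
        also have "n\<Theta> k (c m - c n) < e / (2 * C) + e / (2 * C)"
          using \<Theta>.level_diff_triangle[of "c m" k y "c n"] \<Theta>.level_diff_commute[of y k "c n"]
            N[OF that(1)] N[OF that(2)] cY by fastforce
        finally show ?thesis using C(1) by (simp add: field_simps)
      qed
      then show ?thesis by blast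
    qed
    obtain l where l: "l \<in> XF" "\<And>t. (\<lambda>n. nX t (f n - l)) \<longlonglongrightarrow> 0"
      using X.frechet_complete[of f, OF _ cauchy] f unfolding XF_def by blast
    \<comment> \<open>To identify \<open>y\<close> with \<open>U l\<close> one norm is enough.
      Passing through \<open>c n = U (f n)\<close>, the upper frame bound controls the distance to
      \<open>U l\<close>, and both summands tend to 0.\<close>
    have "n\<Theta> 0 (U l - y) \<le> B 0 * nX (s' 0) (f n - l) + n\<Theta> 0 (c n - y)" for n
    proof -
      have "n\<Theta> 0 (U l - y) \<le> n\<Theta> 0 (c n - U l) + n\<Theta> 0 (c n - y)"
        using \<Theta>.level_diff_triangle[of "U l" 0 "c n" y] \<Theta>.level_diff_commute[of "U l" 0 "c n"]
          cY U_mem[OF l(1)] by simp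
      also have "n\<Theta> 0 (c n - U l) \<le> B 0 * nX (s' 0) (f n - l)"
        using upper[of "f n - l" 0] U_diff f l c X.subspace_diff[OF subXF] by simp
      finally show ?thesis by this simp
    qed
    moreover have "(\<lambda>n. B 0 * nX (s' 0) (f n - l) + n\<Theta> 0 (c n - y)) \<longlonglongrightarrow> B 0 * 0 + 0"
      by (intro tendsto_intros l(2) lim)
    ultimately have "n\<Theta> 0 (U l - y) \<le> 0"
      by (intro LIMSEQ_le_const) auto
    moreover have "U l - y \<in> \<Theta> 0"
      using seq.subspace_diff[OF \<Theta>.level_subspace] U_mem[OF l(1)] cY by blast
    ultimately have "U l - y = 0"
      using \<Theta>.level_nonneg \<Theta>.level_eq_0 by (meson order_antisym)
    then show "y \<in> U ` XF" using l(1) by auto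
  qed
  \<comment> \<open>The witnesses are \<open>W \<circ> P\<close> in one direction and
    \<open>U \<circ> V\<close> in the other.\<close>
  have "(\<exists>P. continuous_projection seq_scale T\<Theta> (U ` XF) P) \<longleftrightarrow>
    (\<exists>V. continuous_operator seq_scale T\<Theta> scaleX TX V \<and> (\<forall>f\<in>XF. V (U f) = f))"
  proof
    assume "\<exists>P. continuous_projection seq_scale T\<Theta> (U ` XF) P"
    then obtain P where P: "continuous_operator seq_scale T\<Theta> seq_scale (subtopology T\<Theta> (U ` XF)) P"
      and range: "P ` topspace T\<Theta> = U ` XF" and idem: "\<forall>x\<in>topspace T\<Theta>. P (P x) = P x"
      unfolding continuous_projection_def by blast
    have "(W \<circ> P) (U f) = f" if "f \<in> XF" for f
    proof -
      \<comment> \<open>Idempotence makes \<open>P\<close> fix every value that it takes, and by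
        surjectivity these values fill the range of \<open>U\<close>.\<close>
      have "U f \<in> P ` topspace T\<Theta>" using range that by blast
      then have "P (U f) = U f" using idem by auto
      then show ?thesis using W_U[OF that] by simp
    qed
    then show "\<exists>V. continuous_operator seq_scale T\<Theta> scaleX TX V \<and> (\<forall>f\<in>XF. V (U f) = f)"
      using continuous_operator_compose[OF P W_cont] by blast
  next
    assume "\<exists>V. continuous_operator seq_scale T\<Theta> scaleX TX V \<and> (\<forall>f\<in>XF. V (U f) = f)"
    then obtain V where V: "continuous_operator seq_scale T\<Theta> scaleX TX V"
      and V_U: "\<And>f. f \<in> XF \<Longrightarrow> V (U f) = f" by blast
    have V_mem: "V x \<in> XF" if "x \<in> topspace T\<Theta>" for x
      using V that top(1) unfolding continuous_operator_def continuous_map_def by blast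
    have "(U \<circ> V) ` topspace T\<Theta> = U ` XF"
    proof
      show "U ` XF \<subseteq> (U \<circ> V) ` topspace T\<Theta>"
      proof
        fix y assume "y \<in> U ` XF"
        then obtain f where f: "f \<in> XF" "y = U f" by blast
        then have "y = (U \<circ> V) (U f)" using V_U by simp
        then show "y \<in> (U \<circ> V) ` topspace T\<Theta>" using f U_mem top(2) by blast
      qed
    qed (use V_mem in auto)
    \<comment> \<open>Idempotence comes from cancelling the inner \<open>V \<circ> U\<close> in
      \<open>U (V (U (V x)))\<close>, which is allowed because \<open>V x\<close> lies in
      \<open>XF\<close>.\<close>
    then have "continuous_projection seq_scale T\<Theta> (U ` XF) (U \<circ> V)"
      using continuous_operator_compose[OF V U_cont] V_U V_mem
      by (auto simp: continuous_projection_def)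
    then show "\<exists>P. continuous_projection seq_scale T\<Theta> (U ` XF) P" by (rule exI[of _ "U \<circ> V"])
  qed
  then show ?thesis
    using closed inj W_cont by (simp add: W_def U_def analysis_operator_def)
qed

end
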